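(* Let $n\ge 1$. The family $\mathcal C_n$ of all distinct full star-simplices and full top-simplices is a good cover of $K_n$ in the simplicial sense: its members (regarded as subcomplexes of $K_n$) cover $K_n$, each member of $\mathcal C_n$ is contractible, and every nonempty finite intersection of members of $\mathcal C_n$ is contractible.
   Context: A partition of $n$ is a weakly decreasing sequence $\lambda=(\lambda_1\ge\cdots\ge\lambda_\ell>0)$ of positive integers with sum $n$, identified with its Ferrers diagram ($\lambda_i$ left-justified cells in row $i$); set $\lambda_{\ell+1}=0$. The partition graph $G_n$ has as vertices all partitions of $n$; two distinct partitions are adjacent if one is obtained from the other by removing one cell from a row, adding it to another row (possibly a new row of length $0$), and reordering the row lengths into weakly decreasing order. $K_n$ is the clique complex of $G_n$: its simplices are the finite nonempty cliques of $G_n$. A removable corner of $\lambda$ is the last cell of a row whose length is strictly greater than that of the next row; an addable corner is a position where a cell can be added so that the result is again a Ferrers diagram of a partition (row $\ell+1$ allowed). Write $r(\cdot)$ for the row number of a corner. For a removable corner $c$ and an addable corner $a$ of $\lambda$ with $r(c)\ne r(a)$, remove $c$ (decrease $\lambda_{r(c)}$ by $1$), add a cell at $a$ (increase $\lambda_{r(a)}$ by $1$), and reorder row lengths. If the result is a partition of $n$ different from $\lambda$, the transfer is called admissible and the result is denoted $\lambda(c\to a)$. The neighbors of $\lambda$ in $G_n$ are exactly the partitions $\lambda(c\to a)$ for admissible transfers. For a removable corner $c$ of $\lambda$: $A_{\max}(\lambda,c):=\{a:\lambda(c\to a)\text{ is admissible}\}$ and the full star-simplex is $\Sigma^{\mathrm{star}}_{\max}(\lambda,c):=\{\lambda\}\cup\{\lambda(c\to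 a):a\in A_{\max}(\lambda,c)\}$. For an addable corner $a$ of $\lambda$: $C_{\max}(\lambda,a):=\{c:\lambda(c\to a)\text{ is admissible}\}$ and the full top-simplex is $\Sigma^{\mathrm{top}}_{\max}(\lambda,a):=\{\lambda\}\cup\{\lambda(c\to a):c\in C_{\max}(\lambda,a)\}$. These are cliques, i.e. simplices of $K_n$; a simplex is regarded as a subcomplex by including all its faces. $\mathcal C_n$ is the set of all full star- and full top-simplices over all partitions $\lambda$ of $n$ and all their corners, with equal simplices identified. *)

theory Defs
  imports "HOL-Analysis.Analysis"
begin

section \<open>Abstract simplicial complexes and good covers\<close>

definition simplicial_complex :: "'a set set \<Rightarrow> bool" where
  "simplicial_complex K \<longleftrightarrow>
     (\<forall>\<sigma>\<in>K. finite \<sigma> \<and> \<sigma> \<noteq> {} \<and> (\<forall>\<tau>. \<tau> \<subseteq> \<sigma> \<and> \<tau> \<noteq> {} \<longrightarrow> \<tau> \<in> K))"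

definition faces :: "'a set \<Rightarrow> 'a set set" where
  "faces \<sigma> = {\<tau>. finite \<tau> \<and> \<tau> \<noteq> {} \<and> \<tau> \<subseteq> \<sigma>}"

text \<open>The closed cell \<open>|\<sigma>|\<close>, in barycentric coordinates indexed by the vertices.\<close>

definition cell :: "'a set \<Rightarrow> ('a \<Rightarrow> real) set" where
  "cell \<sigma> = {x. (\<forall>v. 0 \<le> x v) \<and> (\<forall>v. v \<notin> \<sigma> \<longrightarrow> x v = 0) \<and> (\<Sum>v\<in>\<sigma>. x v) = 1}"

text \<open>The geometric realization carries the coherent (weak) topology: a set is open iff its trace
  on every closed cell is open, the cells having their Euclidean topology.\<close>

definition realization_open :: "'a set set \<Rightarrow> ('a \<Rightarrow> real) set \<Rightarrow> bool" where
  "realization_open K U \<longleftrightarrow> U \<subseteq> (\<Union>\<sigma>\<in>K. cell \<sigma>) \<and>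
     (\<forall>\<sigma>\<in>K. openin (subtopology (powertop_real UNIV) (cell \<sigma>)) (U \<inter> cell \<sigma>))"

definition realization :: "'a set set \<Rightarrow> ('a \<Rightarrow> real) topology" where
  "realization K = topology (realization_open K)"

lemma istopology_realization_open: "istopology (realization_open K)"
  unfolding istopology_def
proof (intro conjI allI impI)
  fix S T assume S: "realization_open K S" and T: "realization_open K T"
  have "(S \<inter> T) \<inter> cell \<sigma> = (S \<inter> cell \<sigma>) \<inter> (T \<inter> cell \<sigma>)" for \<sigma> by blast
  then show "realization_open K (S \<inter> T)"
    using S T unfolding realization_open_def by (auto intro: openin_Int)
next
  fix \<U> assume U: "\<forall>S\<in>\<U>. realization_open K S"
  have eq: "\<Union>\<U> \<inter> cell \<sigma> = \<Union>((\<lambda>S. S \<inter> cell \<sigma>) ` \<U>)" for \<sigma> by blast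
  have "openin (subtopology (powertop_real UNIV) (cell \<sigma>)) (\<Union>\<U> \<inter> cell \<sigma>)" if "\<sigma> \<in> K" for \<sigma>
    unfolding eq using U that by (intro openin_Union) (auto simp: realization_open_def)
  moreover have "\<Union>\<U> \<subseteq> (\<Union>\<sigma>\<in>K. cell \<sigma>)"
    using U by (simp add: realization_open_def Sup_least)
  ultimately show "realization_open K (\<Union>\<U>)"
    by (simp add: realization_open_def)
qed

lemma openin_realization: "openin (realization K) U \<longleftrightarrow> realization_open K U"
  by (simp add: realization_def topology_inverse' istopology_realization_open)

text \<open>The library predicate \<open>contractible_space\<close> holds for the empty space, which is excluded here.\<close>

definition contractible_complex :: "'a set set \<Rightarrow> bool" where
  "contractible_complex K \<longleftrightarrow> K \<noteq> {} \<and> contractible_space (realization K)"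

definition good_cover :: "'a set set \<Rightarrow> 'a set set set \<Rightarrow> bool" where
  "good_cover K \<C> \<longleftrightarrow>
     (\<forall>L\<in>\<C>. simplicial_complex L \<and> L \<subseteq> K) \<and>
     \<Union>\<C> = K \<and>
     (\<forall>L\<in>\<C>. contractible_complex L) \<and>
     (\<forall>\<F>. \<F> \<subseteq> \<C> \<and> finite \<F> \<and> \<F> \<noteq> {} \<and> \<Inter>\<F> \<noteq> {} \<longrightarrow> contractible_complex (\<Inter>\<F>))"

definition clique_complex :: "'a set \<Rightarrow> ('a \<Rightarrow> 'a \<Rightarrow> bool) \<Rightarrow> 'a set set" where
  "clique_complex V adj = {\<sigma>. finite \<sigma> \<and> \<sigma> \<noteq> {} \<and> \<sigma> \<subseteq> V \<and> pairwise adj \<sigma>}"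


section \<open>The partition graph\<close>

definition partitions :: "nat \<Rightarrow> nat list set" where
  "partitions n = {l. sorted_wrt (\<ge>) l \<and> (\<forall>k\<in>set l. 0 < k) \<and> sum_list l = n}"

text \<open>Rows are numbered from 0, so the new row of length 0 has index \<^term>\<open>length l\<close>.\<close>

abbreviation ext :: "nat list \<Rightarrow> nat list" where
  "ext l \<equiv> l @ [0]"

definition reorder :: "nat list \<Rightarrow> nat list" where
  "reorder l = rev (sort (filter (\<lambda>k. 0 < k) l))"

text \<open>Move a cell from row \<open>i\<close> to row \<open>j\<close>; only used for \<open>i < length l\<close>,
  \<open>j \<le> length l\<close> and \<open>i \<noteq> j\<close>.\<close>

definition transfer :: "nat list \<Rightarrow> nat \<Rightarrow> nat \<Rightarrow> nat list" where
  "transfer l i j = reorder ((ext l)[i := ext l ! i - 1, j := ext l ! j + 1])"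

definition obtainable :: "nat list \<Rightarrow> nat list \<Rightarrow> bool" where
  "obtainable l m \<longleftrightarrow> (\<exists>i j. i < length l \<and> j \<le> length l \<and> i \<noteq> j \<and> m = transfer l i j)"

definition adjacent :: "nat list \<Rightarrow> nat list \<Rightarrow> bool" where
  "adjacent l m \<longleftrightarrow> l \<noteq> m \<and> (obtainable l m \<or> obtainable m l)"

definition partition_complex :: "nat \<Rightarrow> nat list set set" where
  "partition_complex n = clique_complex (partitions n) adjacent"


section \<open>Full star- and top-simplices\<close>

text \<open>A corner is determined by its row and is represented by its row index.\<close>

definition removable_corners :: "nat list \<Rightarrow> nat set" where
  "removable_corners l = {c. c < length l \<and> ext l ! c > ext l ! (c + 1)}"

definition addable_corners :: "nat list \<Rightarrow> nat set" where
  "addable_corners l = {a. a \<le> length l \<and> sorted_wrt (\<ge>) ((ext l)[a := ext l ! a + 1])}"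

definition admissible :: "nat list \<Rightarrow> nat \<Rightarrow> nat \<Rightarrow> bool" where
  "admissible l c a \<longleftrightarrow> c \<in> removable_corners l \<and> a \<in> addable_corners l \<and> c \<noteq> a \<and>
     transfer l c a \<in> partitions (sum_list l) \<and> transfer l c a \<noteq> l"

definition A_max :: "nat list \<Rightarrow> nat \<Rightarrow> nat set" where
  "A_max l c = {a. admissible l c a}"

definition C_max :: "nat list \<Rightarrow> nat \<Rightarrow> nat set" where
  "C_max l a = {c. admissible l c a}"

definition star_simplex :: "nat list \<Rightarrow> nat \<Rightarrow> nat list set" where
  "star_simplex l c = {l} \<union> {transfer l c a |a. a \<in> A_max l c}"

definition top_simplex :: "nat list \<Rightarrow> nat \<Rightarrow> nat list set" where
  "top_simplex l a = {l} \<union> {transfer l c a |c. c \<in> C_max l a}"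

definition full_simplices :: "nat \<Rightarrow> nat list set set" where
  "full_simplices n =
     {star_simplex l c |l c. l \<in> partitions n \<and> c \<in> removable_corners l} \<union>
     {top_simplex l a |l a. l \<in> partitions n \<and> a \<in> addable_corners l}"

end

theory Submission
  imports Defs
begin

text \<open>Let \<open>\<lambda>'\<close> be the conjugate of \<open>\<lambda>\<close>, a function on columns. Moving a cell between rows, with
  reordering, always changes \<open>\<lambda>'\<close> by a root \<open>e\<^sub>s - e\<^sub>t\<close>, and two partitions of \<open>n\<close> are adjacent iff
  their conjugates differ by a root with \<open>s \<noteq> t\<close>. A set of vectors pairwise differing by roots lies
  in some \<open>{x + e\<^sub>s | s}\<close> or in some \<open>{y - e\<^sub>t | t}\<close>; these correspond to the star- and
  top-simplices, so every clique is contained in a full simplex. Finally, intersections of simplices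
  are simplices, whose realizations are convex.\<close>

section \<open>Realization of a simplex\<close>

lemma cell_mono:
  assumes "finite \<sigma>" "\<tau> \<subseteq> \<sigma>"
  shows "cell \<tau> \<subseteq> cell \<sigma>"
proof
  fix x assume x: "x \<in> cell \<tau>"
  have "sum x \<sigma> = sum x \<tau>"
    using assms x by (intro sum.mono_neutral_right) (auto simp: cell_def)
  then show "x \<in> cell \<sigma>" using x assms by (auto simp: cell_def)
qed

text \<open>The cell of \<open>\<sigma>\<close> is itself among the cells that test openness, and
  all the others are subspaces of it. Hence the coherent topology collapses to the Euclidean
  one.\<close>

lemma realization_faces:
  assumes "finite \<sigma>" "\<sigma> \<noteq> {}"
  shows "realization (faces \<sigma>) = subtopology (powertop_real UNIV) (cell \<sigma>)"
  unfolding topology_eq openin_realization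
proof (intro allI iffI)
  fix U :: "('a \<Rightarrow> real) set"
  have \<sigma>: "\<sigma> \<in> faces \<sigma>" using assms by (simp add: faces_def)
  have sub: "cell \<tau> \<subseteq> cell \<sigma>" if "\<tau> \<in> faces \<sigma>" for \<tau>
    using cell_mono that assms by (auto simp: faces_def)
  {
    assume U: "realization_open (faces \<sigma>) U"
    then have "U \<subseteq> cell \<sigma>" using sub by (fastforce simp: realization_open_def)
    then have "U \<inter> cell \<sigma> = U" by blast
    with U \<sigma> show "openin (subtopology (powertop_real UNIV) (cell \<sigma>)) U"
      unfolding realization_open_def by metis
  next
    assume "openin (subtopology (powertop_real UNIV) (cell \<sigma>)) U"
    then obtain T where T: "openin (powertop_real UNIV) T" "U = T \<inter> cell \<sigma>"
      by (auto simp: openin_subtopology)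
    have "U \<inter> cell \<tau> = T \<inter> cell \<tau>" if "\<tau> \<in> faces \<sigma>" for \<tau>
      using T sub[OF that] by blast
    with T \<sigma> show "realization_open (faces \<sigma>) U"
      unfolding realization_open_def openin_subtopology by blast
  }
qed

lemma convex_cell:
  assumes "x \<in> cell \<sigma>" "y \<in> cell \<sigma>" "0 \<le> t" "t \<le> 1"
  shows "(\<lambda>v. (1 - t) * x v + t * y v) \<in> cell \<sigma>"
proof -
  have "(\<Sum>v\<in>\<sigma>. (1 - t) * x v + t * y v) = (1 - t) * sum x \<sigma> + t * sum y \<sigma>"
    by (simp add: sum.distrib sum_distrib_left)
  then show ?thesis using assms by (simp add: cell_def)
qed

text \<open>A straight-line homotopy shrinks the convex cell to the vertex \<open>w\<close>.\<close>

lemma contractible_complex_faces: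
  assumes "finite \<sigma>" "\<sigma> \<noteq> {}"
  shows "contractible_complex (faces \<sigma>)"
proof -
  obtain w where w: "w \<in> \<sigma>" using assms by blast
  define a :: "'a \<Rightarrow> real" where "a = (\<lambda>v. if v = w then 1 else 0)"
  have a: "a \<in> cell \<sigma>" using w assms by (auto simp: a_def cell_def)
  let ?X = "subtopology (powertop_real UNIV) (cell \<sigma>)"
  let ?P = "prod_topology (top_of_set {0..1::real}) ?X"
  let ?h = "\<lambda>(t, x). (\<lambda>v. (1 - t) * x v + t * a v)"
  have t: "continuous_map ?P euclideanreal fst"
    using continuous_map_fst continuous_map_into_fulltopology by blast
  have x: "continuous_map ?P euclideanreal (\<lambda>p. snd p v)" for v
  proof -
    have "continuous_map ?P (powertop_real UNIV) snd"
      using continuous_map_snd continuous_map_into_fulltopology by blast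
    then show ?thesis by (simp add: continuous_map_componentwise_UNIV)
  qed
  have "continuous_map ?P euclideanreal (\<lambda>p. ?h p v)" for v
    unfolding case_prod_beta by (intro continuous_intros t x)
  then have "continuous_map ?P (powertop_real UNIV) ?h"
    by (simp add: continuous_map_componentwise_UNIV)
  moreover have "?h ` topspace ?P \<subseteq> cell \<sigma>"
    using convex_cell[OF _ a] by auto
  ultimately have "continuous_map ?P ?X ?h"
    by (auto simp: continuous_map_in_subtopology)
  then have "homotopic_with (\<lambda>x. True) ?X ?X id (\<lambda>x. a)"
    unfolding homotopic_with_def by (intro exI[of _ ?h]) auto
  then have "contractible_space ?X" unfolding contractible_space_def by blast
  moreover have "faces \<sigma> \<noteq> {}" using assms by (auto simp: faces_def)
  ultimately show ?thesis by (simp add: contractible_complex_def realization_faces assms)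
qed

lemma simplicial_complex_faces: "simplicial_complex (faces \<sigma>)"
  by (auto simp: simplicial_complex_def faces_def intro: finite_subset)

text \<open>For empty \<open>S\<close> the left side would be the universal set, which contains the
  empty set, while \<open>faces\<close> excludes it.\<close>

lemma Inter_faces:
  assumes "S \<noteq> {}"
  shows "\<Inter>(faces ` S) = faces (\<Inter>S)"
  using assms by (auto simp: faces_def)

text \<open>Contractibility is automatic for families of simplices, so a good cover reduces to two
  combinatorial facts: members of \<open>S\<close> are simplices of \<open>K\<close>, and every
  simplex of \<open>K\<close> lies in a member.\<close>

lemma good_cover_faces:
  assumes simp: "\<And>\<sigma>. \<sigma> \<in> S \<Longrightarrow> \<sigma> \<in> K"
    and K: "simplicial_complex K"
    and cover: "\<And>\<tau>. \<tau> \<in> K \<Longrightarrow> \<exists>\<sigma>\<in>S. \<tau> \<subseteq> \<sigma>"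
  shows "good_cover K (faces ` S)"
  unfolding good_cover_def
proof (intro conjI ballI allI impI)
  fix L assume "L \<in> faces ` S"
  then obtain \<sigma> where \<sigma>: "\<sigma> \<in> S" "L = faces \<sigma>" by blast
  show "simplicial_complex L" using \<sigma> simplicial_complex_faces by blast
  show "L \<subseteq> K" using \<sigma> simp K by (auto simp: faces_def simplicial_complex_def)
  have "finite \<sigma>" "\<sigma> \<noteq> {}" using simp[OF \<sigma>(1)] K by (auto simp: simplicial_complex_def)
  then show "contractible_complex L" using \<sigma> contractible_complex_faces by blast
next
  show "\<Union>(faces ` S) = K"
  proof (intro equalityI subsetI)
    fix \<tau> assume "\<tau> \<in> \<Union>(faces ` S)"
    then show "\<tau> \<in> K" using simp K unfolding faces_def simplicial_complex_def by blast
  next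
    fix \<tau> assume \<tau>: "\<tau> \<in> K"
    then have "finite \<tau>" "\<tau> \<noteq> {}" using K by (auto simp: simplicial_complex_def)
    then show "\<tau> \<in> \<Union>(faces ` S)" using cover[OF \<tau>] by (auto simp: faces_def)
  qed
next
  fix \<F> assume F: "\<F> \<subseteq> faces ` S \<and> finite \<F> \<and> \<F> \<noteq> {} \<and> \<Inter>\<F> \<noteq> {}"
  then obtain T where T: "T \<subseteq> S" "\<F> = faces ` T" by (meson subset_imageE)
  then have "T \<noteq> {}" using F by blast
  then have eq: "\<Inter>\<F> = faces (\<Inter>T)" using T Inter_faces by blast
  \<comment> \<open>A common face exists, and its vertices lie in every member of
    \<open>T\<close>.\<close>
  then have "faces (\<Inter>T) \<noteq> {}" using F by simp
  then have "\<Inter>T \<noteq> {}" unfolding faces_def by blast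
  moreover obtain \<sigma> where "\<sigma> \<in> T" using \<open>T \<noteq> {}\<close> by blast
  then have "finite \<sigma>" using T simp K unfolding simplicial_complex_def by blast
  then have "finite (\<Inter>T)" using \<open>\<sigma> \<in> T\<close> by (blast intro: finite_Inter)
  ultimately show "contractible_complex (\<Inter>\<F>)" using eq contractible_complex_faces by metis
qed

section \<open>Vectors differing by a root\<close>

text \<open>This is \<open>g = f - e\<^sub>t + e\<^sub>s\<close>. The case \<open>t = s\<close> is
  allowed and means \<open>f = g\<close>, so that a vertex of a clique is also related to
  itself.\<close>

definition root_move :: "('a \<Rightarrow> int) \<Rightarrow> ('a \<Rightarrow> int) \<Rightarrow> 'a \<Rightarrow> 'a \<Rightarrow> bool" where
  "root_move f g t s \<longleftrightarrow> (\<forall>k. g k = f k - of_bool (k = t) + of_bool (k = s))"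

lemma root_move_sym: "root_move f g t s \<Longrightarrow> root_move g f s t"
  by (simp add: root_move_def)

lemma root_move_refl: "root_move f g t t \<longleftrightarrow> f = g"
  by (auto simp: root_move_def)

text \<open>Both \<open>g\<close> and \<open>h\<close> arise from \<open>f - e\<^sub>t\<close> by
  adding one unit vector.\<close>

lemma root_move_common_source:
  "root_move f g t s \<Longrightarrow> root_move f h t s' \<Longrightarrow> root_move g h s s'"
  by (simp add: root_move_def)

text \<open>Both \<open>g\<close> and \<open>h\<close> arise from \<open>f + e\<^sub>s\<close> by
  subtracting one unit vector.\<close>

lemma root_move_common_target:
  "root_move f g t s \<Longrightarrow> root_move f h t' s \<Longrightarrow> root_move g h t' t"
  by (simp add: root_move_def)

text \<open>Otherwise nothing in
  \<open>h - g = e\<^sub>t - e\<^sub>s - e\<^sub>p + e\<^sub>q\<close> cancels the negative entries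
  at \<open>s\<close> and \<open>p\<close>, whereas a root has at most one negative entry, equal to
  -1.\<close>

lemma root_move_third:
  assumes "root_move f g t s" "t \<noteq> s" "root_move f h p q" "p \<noteq> q" "root_move g h u v"
  shows "p = t \<or> q = s"
proof (rule ccontr)
  assume *: "\<not> ?thesis"
  have g: "g k = f k - of_bool (k = t) + of_bool (k = s)"
    and h: "h k = f k - of_bool (k = p) + of_bool (k = q)"
    and gh: "h k - g k = of_bool (k = v) - of_bool (k = u)" for k
    using assms(1,3,5)[unfolded root_move_def, THEN spec, of k] by linarith+
  \<comment> \<open>Only an inequality at this point: the entry is -2 when \<open>p = s\<close>,
    which is excluded afterwards.\<close>
  have "h s - g s \<le> - 1" using g[of s] h[of s] * \<open>t \<noteq> s\<close> by auto
  then have "s = u" using gh[of s] by (auto simp: of_bool_def split: if_splits)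
  then have "p \<noteq> s" using g[of s] h[of s] gh[of s] * assms(2,4) by (auto simp: of_bool_def split: if_splits)
  then have "h p - g p = - 1" using g[of p] h[of p] * \<open>p \<noteq> q\<close> by auto
  then have "p = u" using gh[of p] by (auto simp: of_bool_def split: if_splits)
  with \<open>s = u\<close> \<open>p \<noteq> s\<close> show False by simp
qed

text \<open>The simplices through an edge split into two types, which cannot be mixed: if
  \<open>h = f - e\<^sub>t + e\<^sub>q\<close> and \<open>h' = f - e\<^sub>p + e\<^sub>s\<close>, then \<open>h' - h\<close> is positive at both \<open>t\<close> and \<open>s\<close>.\<close>

lemma root_move_mixed:
  assumes "root_move f h t q" "root_move f h' p s" "t \<noteq> s" "q \<noteq> t" "q \<noteq> s" "p \<noteq> s" "p \<noteq> t"
  shows "\<not> root_move h h' u v"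
proof
  assume hh': "root_move h h' u v"
  have h: "h k = f k - of_bool (k = t) + of_bool (k = q)"
    and h': "h' k = f k - of_bool (k = p) + of_bool (k = s)"
    and d: "h' k - h k = of_bool (k = v) - of_bool (k = u)" for k
    using assms(1,2)[unfolded root_move_def, THEN spec, of k]
      hh'[unfolded root_move_def, THEN spec, of k] by linarith+
  have "h' t - h t = 1" "h' s - h s = 1"
    using h[of t] h'[of t] h[of s] h'[of s] assms(3-) by simp_all
  then have "t = v" "s = v" using d[of t] d[of s] by (auto simp: of_bool_def split: if_splits)
  with \<open>t \<noteq> s\<close> show False by simp
qed

text \<open>The edge fixes a source \<open>t\<close> and a target \<open>s\<close>. By
  \<open>root_move_third\<close> every vertex shares one of them with the edge; a vertex violating
  the first alternative and one violating the second would form a mixed pair.\<close>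

lemma root_clique_cases:
  assumes edge: "a \<in> \<sigma>" "b \<in> \<sigma>" "root_move (F a) (F b) t s" "t \<noteq> s"
    and clique: "\<And>x y. x \<in> \<sigma> \<Longrightarrow> y \<in> \<sigma> \<Longrightarrow> \<exists>u v. root_move (F x) (F y) u v"
  shows "(\<forall>x\<in>\<sigma>. \<exists>q. root_move (F a) (F x) t q) \<or> (\<forall>x\<in>\<sigma>. \<exists>p. root_move (F a) (F x) p s)"
proof (rule ccontr)
  assume "\<not> ?thesis"
  then obtain x y where xy: "x \<in> \<sigma>" "y \<in> \<sigma>"
    and x: "\<And>q. \<not> root_move (F a) (F x) t q" and y: "\<And>p. \<not> root_move (F a) (F y) p s"
    by blast
  have dich: "(\<exists>q. root_move (F a) (F z) t q) \<or> (\<exists>p. root_move (F a) (F z) p s)"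
    if "z \<in> \<sigma>" for z
  proof -
    obtain p q where pq: "root_move (F a) (F z) p q" using clique[OF edge(1) \<open>z \<in> \<sigma>\<close>] by blast
    show ?thesis
    proof (cases "p = q")
      case True
      then have "root_move (F a) (F z) t t" using pq by (simp add: root_move_refl)
      then show ?thesis by blast
    next
      case False
      obtain u v where "root_move (F b) (F z) u v" using clique[OF edge(2) \<open>z \<in> \<sigma>\<close>] by blast
      then show ?thesis using root_move_third[OF edge(3,4) pq False] pq by blast
    qed
  qed
  obtain p where p: "root_move (F a) (F x) p s" using dich[OF xy(1)] x by blast
  obtain q where q: "root_move (F a) (F y) t q" using dich[OF xy(2)] y by blast
  \<comment> \<open>A degenerate move would make the vector equal to \<open>F a\<close>, which
    belongs to both families; this gives the distinctness from \<open>s\<close> for \<open>p\<close>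
    and from \<open>t\<close> for \<open>q\<close>.\<close>
  have "p \<noteq> t" using p x by blast
  moreover have "p \<noteq> s" using p x root_move_refl by metis
  moreover have "q \<noteq> s" using q y by blast
  moreover have "q \<noteq> t" using q y root_move_refl by metis
  ultimately show False
    using root_move_mixed[OF q p edge(4)] clique[OF xy(2,1)] by blast
qed

section \<open>Conjugate partitions\<close>

text \<open>The conjugate partition, with columns numbered from 0: the height of column
  \<open>k\<close>.\<close>

definition col :: "nat list \<Rightarrow> nat \<Rightarrow> nat" where
  "col l k = length (filter (\<lambda>r. k < r) l)"

lemma col_Cons: "col (a # l) k = of_bool (k < a) + col l k"
  by (simp add: col_def)

lemma col_mset: "col l k = size (filter_mset (\<lambda>r. k < r) (mset l))"
  by (simp add: col_def flip: mset_filter)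

lemma col_antimono: "j \<le> k \<Longrightarrow> col l k \<le> col l j"
  unfolding col_mset by (intro size_mset_mono filter_mset_mono_strong) auto

lemma col_update:
  "i < length l \<Longrightarrow> int (col (l[i := v]) k) = int (col l k) - of_bool (k < l ! i) + of_bool (k < v)"
proof (induction l arbitrary: i)
  case (Cons a l)
  then show ?case by (cases i) (simp_all add: col_Cons)
qed simp

lemma mset_reorder: "mset (reorder l) = filter_mset (\<lambda>k. 0 < k) (mset l)"
  by (simp add: reorder_def)

text \<open>Column heights ignore the order of rows and rows of length 0, so reordering is invisible
  in the conjugate.\<close>

lemma col_reorder: "col (reorder l) = col l"
  by (auto simp: col_mset mset_reorder filter_filter_mset intro!: ext arg_cong[where f = size] filter_mset_cong)

lemma partitionsD:
  assumes "l \<in> partitions n"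
  shows "sorted_wrt (\<ge>) l" "\<And>i. i < length l \<Longrightarrow> 0 < l ! i" "sum_list l = n"
  using assms by (auto simp: partitions_def)

text \<open>For positive \<open>k\<close>, exactly \<open>col l (k - 1) - col l k\<close> rows have
  length \<open>k\<close>. This recovers the multiset of rows, and sortedness recovers the
  list.\<close>

lemma col_inject:
  assumes "l \<in> partitions n" "m \<in> partitions n'" "col l = col m"
  shows "l = m"
proof -
  have count: "count (mset x) k = (if k = 0 then 0 else col x (k - 1) - col x k)"
    if "x \<in> partitions d" for x d k
  proof (cases k)
    case 0
    then show ?thesis using that by (auto simp: partitions_def count_eq_zero_iff)
  next
    case (Suc j)
    have "length (filter (\<lambda>r. j < r) x) = count (mset x) (Suc j) + length (filter (\<lambda>r. Suc j < r) x)"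
      by (induction x) auto
    then show ?thesis using Suc by (simp add: col_def)
  qed
  have "mset l = mset m"
    using assms by (intro multiset_eqI) (simp add: count)
  moreover have "sorted (rev l)" "sorted (rev m)"
    using assms by (auto simp: partitions_def sorted_wrt_rev)
  ultimately have "rev l = rev m"
    by (metis mset_rev properties_for_sort)
  then show ?thesis by simp
qed

lemma transfer_in_partitions:
  assumes "l \<in> partitions n" "i < length l" "j \<le> length l" "i \<noteq> j"
  shows "transfer l i j \<in> partitions n"
proof -
  let ?x = "(ext l)[i := ext l ! i - 1, j := ext l ! j + 1]"
  have sum: "sum_list (reorder x) = sum_list x" for x
  proof -
    have "sum_list (reorder x) = sum_mset (mset (reorder x))" by (simp add: sum_mset_sum_list)
    also have "\<dots> = sum_mset (mset x)" unfolding mset_reorder by (induction x) auto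
    finally show ?thesis by (simp add: sum_mset_sum_list)
  qed
  have upd: "sum_list (x[k := v]) + x ! k = sum_list x + v" if "k < length x" for x :: "nat list" and k v
    using that by (induction x arbitrary: k) (auto split: nat.splits simp: nth_Cons)
  \<comment> \<open>Positivity makes the truncated subtraction in \<open>transfer\<close> remove a
    real cell.\<close>
  have "0 < ext l ! i" using partitionsD(2)[OF assms(1,2)] assms(2) by (simp add: nth_append)
  then have "sum_list ?x = sum_list l"
    using upd[of i "ext l" "ext l ! i - 1"] upd[of j "(ext l)[i := ext l ! i - 1]" "ext l ! j + 1"] assms
    by simp
  then have "sum_list (transfer l i j) = n"
    using assms(1) by (simp add: transfer_def sum partitions_def)
  moreover have "sorted_wrt (\<ge>) (reorder x)" "\<forall>k\<in>set (reorder x). 0 < k" for x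
    by (auto simp: reorder_def sorted_wrt_rev)
  ultimately show ?thesis by (simp add: partitions_def transfer_def)
qed

abbreviation icol :: "nat list \<Rightarrow> nat \<Rightarrow> int" where
  "icol l \<equiv> \<lambda>k. int (col l k)"

lemma icol_inject:
  assumes "l \<in> partitions n" "m \<in> partitions n'" "icol l = icol m"
  shows "l = m"
proof (rule col_inject[OF assms(1,2)])
  show "col l = col m" using assms(3) by (simp add: fun_eq_iff)
qed

lemma root_move_refl_partition:
  assumes "l \<in> partitions n" "m \<in> partitions n'" "root_move (icol l) (icol m) t t"
  shows "l = m"
  using icol_inject[OF assms(1,2)] assms(3) unfolding root_move_refl by blast

text \<open>Shortening a row of length \<open>r\<close> takes a cell from column
  \<open>r - 1\<close>; lengthening a row of length \<open>r\<close> puts one into column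
  \<open>r\<close>.\<close>

lemma root_move_transfer:
  assumes "l \<in> partitions n" "i < length l" "j \<le> length l" "i \<noteq> j"
  shows "root_move (icol l) (icol (transfer l i j)) (l ! i - 1) (ext l ! j)"
proof -
  have "0 < l ! i" using partitionsD(2)[OF assms(1,2)] .
  moreover have "col (ext l) k = col l k" for k by (simp add: col_def)
  moreover have "ext l ! i = l ! i" using assms by (simp add: nth_append)
  ultimately show ?thesis
    using assms unfolding root_move_def transfer_def col_reorder
    by (auto simp: col_update of_bool_def)
qed

section \<open>Corners\<close>

text \<open>Rows longer than \<open>k\<close> form an initial segment, so both sides say that the
  cell in row \<open>i\<close> and column \<open>k\<close> belongs to the diagram.\<close>

lemma less_col_iff:
  assumes "sorted_wrt (\<ge>) l"
  shows "i < col l k \<longleftrightarrow> i < length l \<and> k < l ! i"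
  using assms
proof (induction l arbitrary: i)
  case Nil
  then show ?case by (simp add: col_def)
next
  case (Cons a l)
  show ?case
  proof (cases "k < a")
    case True
    then show ?thesis using Cons by (cases i) (auto simp: col_def)
  next
    case False
    then have "filter (\<lambda>r. k < r) (a # l) = []" using Cons.prems by (fastforce simp: filter_empty_conv)
    moreover have "(a # l) ! i \<le> a" if "i < length (a # l)"
      using that Cons.prems by (cases i) auto
    ultimately show ?thesis using False unfolding col_def by fastforce
  qed
qed

lemma less_col_iff_ext:
  assumes "l \<in> partitions n" "i \<le> length l"
  shows "i < col l k \<longleftrightarrow> k < ext l ! i"
  using less_col_iff[OF partitionsD(1)[OF assms(1)]] assms(2) by (auto simp: nth_append)

lemma col_le_length: "col l k \<le> length l"
  by (simp add: col_def)

text \<open>A removable corner is the bottom cell of its column, so the column determines the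
  row.\<close>

lemma removable_corner_row:
  assumes "l \<in> partitions n" "c \<in> removable_corners l"
  shows "Suc c = col l (l ! c - 1)"
proof -
  have c: "c < length l" "ext l ! (c + 1) < ext l ! c" "ext l ! c = l ! c"
    using assms by (auto simp: removable_corners_def nth_append)
  then have "c < col l (l ! c - 1)" "\<not> Suc c < col l (l ! c - 1)"
    using less_col_iff_ext[OF assms(1), of c "l ! c - 1"] less_col_iff_ext[OF assms(1), of "Suc c" "l ! c - 1"]
    by auto
  then show ?thesis by linarith
qed

text \<open>An addable corner is the first free place of its column.\<close>

lemma addable_corner_row:
  assumes "l \<in> partitions n" "a \<in> addable_corners l"
  shows "a = col l (ext l ! a)"
proof -
  have a: "a \<le> length l" "sorted_wrt (\<ge>) ((ext l)[a := ext l ! a + 1])"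
    using assms by (auto simp: addable_corners_def)
  have "ext l ! a < ext l ! (a - 1)" if "0 < a"
  proof -
    have "a - 1 < a" "a < length ((ext l)[a := ext l ! a + 1])" using that a(1) by auto
    from sorted_wrt_nth_less[OF a(2) this] that a(1) show ?thesis by simp
  qed
  then have "\<not> a < col l (ext l ! a)" "0 < a \<Longrightarrow> a - 1 < col l (ext l ! a)"
    using less_col_iff_ext[OF assms(1), of a "ext l ! a"]
      less_col_iff_ext[OF assms(1), of "a - 1" "ext l ! a"] a(1) by auto
  then show ?thesis by linarith
qed

text \<open>If column \<open>t\<close> is higher than the next one, its bottom cell ends a row of
  length \<open>t + 1\<close>.\<close>

lemma removable_cornerI:
  assumes l: "l \<in> partitions n" and less: "col l (Suc t) < col l t"
  shows "col l t - 1 \<in> removable_corners l" "l ! (col l t - 1) = Suc t"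
proof -
  let ?c = "col l t - 1"
  have c: "?c < length l" using less col_le_length[of l t] by linarith
  then have "t < ext l ! ?c" "\<not> Suc t < ext l ! ?c" "\<not> t < ext l ! (?c + 1)"
    using less_col_iff_ext[OF l, of ?c t] less_col_iff_ext[OF l, of ?c "Suc t"]
      less_col_iff_ext[OF l, of "?c + 1" t] less by auto
  with c show "?c \<in> removable_corners l" "l ! ?c = Suc t"
    by (auto simp: removable_corners_def nth_append)
qed

lemma addable_cornerI:
  assumes l: "l \<in> partitions n" and less: "s = 0 \<or> col l s < col l (s - 1)"
  shows "col l s \<in> addable_corners l" "ext l ! col l s = s"
proof -
  let ?a = "col l s"
  have a: "?a \<le> length l" by (rule col_le_length)
  have "\<not> s < ext l ! ?a" "s = 0 \<or> s - 1 < ext l ! ?a"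
    using less_col_iff_ext[OF l a, of s] less_col_iff_ext[OF l a, of "s - 1"] less by auto
  then show eq: "ext l ! ?a = s" by linarith
  \<comment> \<open>The rows above the new cell already reach past column \<open>s\<close>, so
    lengthening this row keeps the order.\<close>
  have before: "Suc s \<le> ext l ! i" if "i < ?a" for i
    using less_col_iff_ext[OF l, of i s] that a by simp
  have srt: "sorted_wrt (\<ge>) (ext l)" using partitionsD(1)[OF l] by (simp add: sorted_wrt_append)
  have "sorted_wrt (\<ge>) ((ext l)[?a := Suc s])"
    unfolding sorted_wrt_iff_nth_less
  proof (intro allI impI)
    fix i j assume ij: "i < j" "j < length ((ext l)[?a := Suc s])"
    have "ext l ! j \<le> ext l ! i" using sorted_wrt_nth_less[OF srt ij(1)] ij by simp
    then show "(ext l)[?a := Suc s] ! j \<le> (ext l)[?a := Suc s] ! i"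
      using ij before[of i] eq by (cases "i = ?a"; cases "j = ?a") auto
  qed
  then show "?a \<in> addable_corners l" using eq a by (simp add: addable_corners_def)
qed

text \<open>The conjugate of \<open>m\<close> is again weakly decreasing, which forces column
  \<open>t\<close> to end in a removable corner and column \<open>s\<close> in an addable one. The
  transfer between them has the conjugate of \<open>m\<close>, hence equals
  \<open>m\<close>.\<close>

lemma root_move_admissible:
  assumes l: "l \<in> partitions n" and m: "m \<in> partitions n"
    and mv: "root_move (icol l) (icol m) t s" and "t \<noteq> s"
  shows "admissible l (col l t - 1) (col l s)" "transfer l (col l t - 1) (col l s) = m"
proof -
  let ?c = "col l t - 1" and ?a = "col l s"
  have eq: "int (col m k) = int (col l k) - of_bool (k = t) + of_bool (k = s)" for k
    using mv by (simp add: root_move_def)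
  have t: "col l (Suc t) < col l t"
    using eq[of t] eq[of "Suc t"] col_antimono[of t "Suc t" m] \<open>t \<noteq> s\<close> by (simp split: if_splits add: of_bool_def)
  have s: "s = 0 \<or> col l s < col l (s - 1)"
    using eq[of s] eq[of "s - 1"] col_antimono[of "s - 1" s m] \<open>t \<noteq> s\<close>
    by (cases s) (auto simp: of_bool_def split: if_splits)
  note c = removable_cornerI[OF l t] and a = addable_cornerI[OF l s]
  have clen: "?c < length l" and alen: "?a \<le> length l"
    using c(1) a(1) by (auto simp: removable_corners_def addable_corners_def)
  \<comment> \<open>In a common row, \<open>s = t + 1\<close> and column \<open>s\<close> is one
    cell lower than column \<open>t\<close>; the move would leave it one cell higher in
    \<open>m\<close>.\<close>
  have ne: "?c \<noteq> ?a"
  proof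
    assume ca: "?c = ?a"
    then have "s = Suc t" using c(2) a(2) clen by (simp add: nth_append)
    then show False
      using ca t eq[of t] eq[of "Suc t"] col_antimono[of t "Suc t" m] by simp
  qed
  have tp: "transfer l ?c ?a \<in> partitions n"
    using transfer_in_partitions[OF l clen alen ne] .
  have "root_move (icol l) (icol (transfer l ?c ?a)) t s"
    using root_move_transfer[OF l clen alen ne] c(2) a(2) by simp
  then have "icol (transfer l ?c ?a) = icol m"
    using mv by (simp add: root_move_def)
  then show tm: "transfer l ?c ?a = m" using icol_inject tp m by blast
  have "l \<noteq> m" using eq[of t] \<open>t \<noteq> s\<close> by auto
  then show "admissible l ?c ?a"
    using c a ne tp tm partitionsD(3)[OF l] by (simp add: admissible_def)
qed

text \<open>Root moves are reversible, so both directions of \<open>obtainable\<close> give the same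
  condition; conversely, a nontrivial move is realized by corners.\<close>

lemma adjacent_iff_root_move:
  assumes l: "l \<in> partitions n" and m: "m \<in> partitions n"
  shows "adjacent l m \<longleftrightarrow> l \<noteq> m \<and> (\<exists>t s. root_move (icol l) (icol m) t s)"
proof -
  have "\<exists>t s. root_move (icol x) (icol y) t s" if "x \<in> partitions n" "obtainable x y" for x y
    using that root_move_transfer unfolding obtainable_def by blast
  then have "l \<noteq> m \<and> (\<exists>t s. root_move (icol l) (icol m) t s)" if "adjacent l m"
    using that l m root_move_sym unfolding adjacent_def by meson
  moreover have "adjacent l m" if ne: "l \<noteq> m" and mv: "root_move (icol l) (icol m) t s" for t s
  proof -
    have "t \<noteq> s" using mv ne root_move_refl_partition[OF l m] by blast
    note * = root_move_admissible[OF l m mv this]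
    then have "obtainable l m"
      unfolding obtainable_def admissible_def removable_corners_def addable_corners_def by blast
    then show ?thesis using ne by (simp add: adjacent_def)
  qed
  ultimately show ?thesis by blast
qed

section \<open>Full simplices\<close>

lemma admissibleD:
  assumes "l \<in> partitions n" "admissible l c a"
  shows "transfer l c a \<in> partitions n"
    "root_move (icol l) (icol (transfer l c a)) (l ! c - 1) (ext l ! a)"
  using assms root_move_transfer[OF assms(1), of c a] partitionsD(3)[OF assms(1)]
  by (auto simp: admissible_def removable_corners_def addable_corners_def)

text \<open>In conjugate coordinates the star consists of the partitions
  \<open>x + e\<^sub>s\<close> for the fixed vector \<open>x = icol l - e\<^sub>t\<close> with
  \<open>t = l ! c - 1\<close>; the choice \<open>s = t\<close> gives \<open>l\<close>
  itself.\<close>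

lemma star_simplex_eq:
  assumes l: "l \<in> partitions n" and c: "c \<in> removable_corners l"
  shows "star_simplex l c = {m \<in> partitions n. \<exists>s. root_move (icol l) (icol m) (l ! c - 1) s}"
proof (intro equalityI subsetI)
  fix m assume "m \<in> star_simplex l c"
  then consider "m = l" | a where "admissible l c a" "m = transfer l c a"
    by (auto simp: star_simplex_def A_max_def)
  then show "m \<in> {m \<in> partitions n. \<exists>s. root_move (icol l) (icol m) (l ! c - 1) s}"
  proof cases
    case 1
    then show ?thesis using l root_move_refl[of "icol l"] by blast
  next
    case 2
    then show ?thesis using admissibleD[OF l 2(1)] by blast
  qed
next
  fix m assume "m \<in> {m \<in> partitions n. \<exists>s. root_move (icol l) (icol m) (l ! c - 1) s}"
  then obtain s where m: "m \<in> partitions n" and mv: "root_move (icol l) (icol m) (l ! c - 1) s"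
    by blast
  show "m \<in> star_simplex l c"
  proof (cases "l ! c - 1 = s")
    case True
    then have "l = m" using mv root_move_refl_partition[OF l m] by simp
    then show ?thesis by (simp add: star_simplex_def)
  next
    case False
    have "col l (l ! c - 1) - 1 = c" using removable_corner_row[OF l c] by simp
    then show ?thesis using root_move_admissible[OF l m mv False]
      by (auto simp: star_simplex_def A_max_def)
  qed
qed

lemma top_simplex_eq:
  assumes l: "l \<in> partitions n" and a: "a \<in> addable_corners l"
  shows "top_simplex l a = {m \<in> partitions n. \<exists>t. root_move (icol l) (icol m) t (ext l ! a)}"
proof (intro equalityI subsetI)
  fix m assume "m \<in> top_simplex l a"
  then consider "m = l" | c where "admissible l c a" "m = transfer l c a"
    by (auto simp: top_simplex_def C_max_def)
  then show "m \<in> {m \<in> partitions n. \<exists>t. root_move (icol l) (icol m) t (ext l ! a)}"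
  proof cases
    case 1
    then show ?thesis using l root_move_refl[of "icol l"] by blast
  next
    case 2
    then show ?thesis using admissibleD[OF l 2(1)] by blast
  qed
next
  fix m assume "m \<in> {m \<in> partitions n. \<exists>t. root_move (icol l) (icol m) t (ext l ! a)}"
  then obtain t where m: "m \<in> partitions n" and mv: "root_move (icol l) (icol m) t (ext l ! a)"
    by blast
  show "m \<in> top_simplex l a"
  proof (cases "t = ext l ! a")
    case True
    then have "l = m" using mv root_move_refl_partition[OF l m] by simp
    then show ?thesis by (simp add: top_simplex_def)
  next
    case False
    then show ?thesis
      using root_move_admissible[OF l m mv False] addable_corner_row[OF l a]
      by (auto simp: top_simplex_def C_max_def)
  qed
qed

lemma finite_star_simplex: "finite (star_simplex l c)"
proof -
  have "A_max l c \<subseteq> {..length l}"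
    by (auto simp: A_max_def admissible_def addable_corners_def)
  then have "finite (A_max l c)" using finite_subset by blast
  then show ?thesis by (simp add: star_simplex_def)
qed

lemma finite_top_simplex: "finite (top_simplex l a)"
proof -
  have "C_max l a \<subseteq> {..length l}"
    by (auto simp: C_max_def admissible_def removable_corners_def)
  then have "finite (C_max l a)" using finite_subset by blast
  then show ?thesis by (simp add: top_simplex_def)
qed

lemma full_simplex_in_partition_complex:
  assumes "\<sigma> \<in> full_simplices n"
  shows "\<sigma> \<in> partition_complex n"
proof -
  have "finite \<sigma>" "\<sigma> \<noteq> {}"
    using assms finite_star_simplex finite_top_simplex
    by (auto simp: full_simplices_def star_simplex_def top_simplex_def)
  moreover have "\<sigma> \<subseteq> partitions n \<and> (\<forall>x\<in>\<sigma>. \<forall>y\<in>\<sigma>. \<exists>t s. root_move (icol x) (icol y) t s)"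
    using assms unfolding full_simplices_def
  proof (elim UnE CollectE exE conjE)
    fix l c assume "\<sigma> = star_simplex l c" "l \<in> partitions n" "c \<in> removable_corners l"
    then show ?thesis using root_move_common_source by (fastforce simp: star_simplex_eq)
  next
    fix l a assume "\<sigma> = top_simplex l a" "l \<in> partitions n" "a \<in> addable_corners l"
    then show ?thesis using root_move_common_target by (fastforce simp: top_simplex_eq)
  qed
  ultimately show ?thesis
    unfolding partition_complex_def clique_complex_def pairwise_def
    using adjacent_iff_root_move by blast
qed

lemma clique_subset_full_simplex:
  assumes "n \<ge> 1" and \<tau>: "\<tau> \<in> partition_complex n"
  shows "\<exists>\<sigma>\<in>full_simplices n. \<tau> \<subseteq> \<sigma>"
proof -
  have sub: "\<tau> \<subseteq> partitions n" "\<tau> \<noteq> {}" and pw: "pairwise adjacent \<tau>"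
    using \<tau> by (auto simp: partition_complex_def clique_complex_def)
  have clique: "\<exists>u v. root_move (icol x) (icol y) u v" if "x \<in> \<tau>" "y \<in> \<tau>" for x y
  proof (cases "x = y")
    case True
    then show ?thesis using root_move_refl[of "icol x"] by blast
  next
    case False
    then show ?thesis using pw that sub adjacent_iff_root_move unfolding pairwise_def by blast
  qed
  obtain l where l: "l \<in> \<tau>" "l \<in> partitions n" using sub by blast
  show ?thesis
  proof (cases "\<tau> = {l}")
    case True
    \<comment> \<open>Here \<open>n \<ge> 1\<close> enters: a single vertex lies in the star at the
      last row, which is always a removable corner.\<close>
    have "l \<noteq> []" using l assms(1) by (auto simp: partitions_def)
    then have "length l - 1 \<in> removable_corners l"
      using partitionsD(2)[OF l(2), of "length l - 1"]
      by (simp add: removable_corners_def nth_append)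
    then have "star_simplex l (length l - 1) \<in> full_simplices n"
      using l by (auto simp: full_simplices_def)
    then show ?thesis using True by (auto simp: star_simplex_def)
  next
    case False
    then obtain m where m: "m \<in> \<tau>" "m \<noteq> l" using l by blast
    then have mp: "m \<in> partitions n" using sub by blast
    obtain t s where mv: "root_move (icol l) (icol m) t s" using clique l m by blast
    have ne: "t \<noteq> s" using mv m root_move_refl_partition[OF l(2) mp] by blast
    let ?c = "col l t - 1" and ?a = "col l s"
    have adm: "admissible l ?c ?a" and tr: "transfer l ?c ?a = m"
      using root_move_admissible[OF l(2) mp mv ne] by auto
    then have c: "?c \<in> removable_corners l" and a: "?a \<in> addable_corners l"
      by (auto simp: admissible_def)
    \<comment> \<open>The edge is rewritten with the columns of its two corners, matching the
      descriptions of the star and the top simplex.\<close>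
    have "root_move (icol l) (icol m) (l ! ?c - 1) (ext l ! ?a)"
      using admissibleD(2)[OF l(2) adm] tr by simp
    moreover have "l ! ?c - 1 \<noteq> ext l ! ?a"
      using calculation m root_move_refl_partition[OF l(2) mp] by auto
    ultimately consider
      "\<forall>x\<in>\<tau>. \<exists>q. root_move (icol l) (icol x) (l ! ?c - 1) q" |
      "\<forall>x\<in>\<tau>. \<exists>p. root_move (icol l) (icol x) p (ext l ! ?a)"
      using root_clique_cases[of l \<tau> m icol, OF l(1) m(1) _ _ clique] by blast
    then show ?thesis
    proof cases
      case 1
      then have "\<tau> \<subseteq> star_simplex l ?c" using star_simplex_eq[OF l(2) c] sub by auto
      then show ?thesis using l c unfolding full_simplices_def by blast
    next
      case 2
      then have "\<tau> \<subseteq> top_simplex l ?a" using top_simplex_eq[OF l(2) a] sub by auto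
      then show ?thesis using l a unfolding full_simplices_def by blast
    qed
  qed
qed

lemma simplicial_complex_clique_complex: "simplicial_complex (clique_complex V adj)"
  unfolding simplicial_complex_def clique_complex_def
  by (auto intro: finite_subset pairwise_subset)

theorem theorem4p4:
  fixes n :: nat
  assumes "n \<ge> 1"
  shows "good_cover (partition_complex n) (faces ` full_simplices n)"
proof (rule good_cover_faces)
  show "simplicial_complex (partition_complex n)"
    unfolding partition_complex_def by (rule simplicial_complex_clique_complex)
qed (use full_simplex_in_partition_complex clique_subset_full_simplex[OF assms] in blast)+

end
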